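(* Let $\Omega$ be an arbitrary domain in $\mathbf{R}^n$ and let $\mu\in(0,\infty]$. For $f\in BMO^{\mu,\nu}_b(\Omega)$ with $\nu\ge2\mu$, let $f_0$ be the zero extension of $f$ to $\mathbf{R}^n$, i.e. $f_0(x)=0$ for $x\in\Omega^c$ and $f_0(x)=f(x)$ for $x\in\Omega$. Then $f_0\in BMO^\mu(\mathbf{R}^n)$ and $$[f_0]_{BMO^\mu(\mathbf{R}^n)}\le C\,\|f\|_{BMO^{\mu,\nu}_b(\Omega)}$$ with $C$ independent of $f$.
   Context: $\Gamma=\partial\Omega$; $B_r(x)$ is the closed ball; $f_B=\frac1{|B|}\int_Bf\,dy$. For a domain $D$ and $f\in L^1_{\mathrm{loc}}(D)$, $\mu,\nu\in(0,\infty]$: $$[f]_{BMO^\mu(D)}=\sup\Big\{\tfrac1{|B_r(x)|}\int_{B_r(x)}|f-f_{B_r(x)}|\,dy : B_r(x)\subset D,\ r<\mu\Big\},$$ and $BMO^\mu(D)$ is the space of $f\in L^1_{\mathrm{loc}}(D)$ with $[f]_{BMO^\mu(D)}<\infty$. For $f\in L^1_{\mathrm{loc}}(\Omega)$, $$[f]_{b^\nu}=\sup\Big\{r^{-n}\int_{\Omega\cap B_r(x)}|f|\,dy : x\in\Gamma,\ 0<r<\nu\Big\},$$ and $BMO^{\mu,\nu}_b(\Omega)$ is the space of $f\in L^1_{\mathrm{loc}}(\Omega)$ with $\|f\|_{BMO^{\mu,\nu}_b}=[f]_{BMO^\mu(\Omega)}+[f]_{b^\nu}<\infty$. *)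

theory Defs
  imports "HOL-Analysis.Analysis"
begin

definition is_domain :: "(real ^ 'n) set \<Rightarrow> bool" where
  "is_domain D \<longleftrightarrow> D \<noteq> {} \<and> open D \<and> connected D"

text \<open>
  Functions on a domain \<open>D\<close> are total functions whose values outside \<open>D\<close> are irrelevant.
  As an open set is a countable union of compact sets, membership in
  the following space includes Lebesgue measurability on \<open>D\<close>.
\<close>

definition L1_loc :: "(real ^ 'n) set \<Rightarrow> (real ^ 'n \<Rightarrow> real) set" where
  "L1_loc D = {f. \<forall>K. compact K \<and> K \<subseteq> D \<longrightarrow> f absolutely_integrable_on K}"

definition average :: "(real ^ 'n \<Rightarrow> real) \<Rightarrow> (real ^ 'n) set \<Rightarrow> real" where
  "average f B = (LINT y:B|lebesgue. f y) / measure lebesgue B"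

text \<open>
  The radii bounds \<open>\<mu>\<close>, \<open>\<nu>\<close> range over \<open>(0,\<infinity>]\<close>. The seminorms take values in \<open>[0,\<infinity>]\<close>; in
  particular the supremum over the empty set is \<open>0\<close> (relevant for \<open>b_seminorm\<close> if \<open>\<Omega>\<close> is the
  whole space).
\<close>

definition BMO_seminorm :: "ennreal \<Rightarrow> (real ^ 'n) set \<Rightarrow> (real ^ 'n \<Rightarrow> real) \<Rightarrow> ennreal" where
  "BMO_seminorm \<mu> D f =
    Sup {(\<integral>\<^sup>+y\<in>cball x r. ennreal \<bar>f y - average f (cball x r)\<bar> \<partial>lebesgue)
           / emeasure lebesgue (cball x r) | x r.
         0 < r \<and> cball x r \<subseteq> D \<and> ennreal r < \<mu>}"

definition BMO :: "ennreal \<Rightarrow> (real ^ 'n) set \<Rightarrow> (real ^ 'n \<Rightarrow> real) set" where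
  "BMO \<mu> D = {f \<in> L1_loc D. BMO_seminorm \<mu> D f < \<infinity>}"

definition b_seminorm :: "ennreal \<Rightarrow> (real ^ 'n) set \<Rightarrow> (real ^ 'n \<Rightarrow> real) \<Rightarrow> ennreal" where
  "b_seminorm \<nu> \<Omega> f =
    Sup {(\<integral>\<^sup>+y\<in>\<Omega> \<inter> cball x r. ennreal \<bar>f y\<bar> \<partial>lebesgue) / ennreal (r ^ CARD('n)) | x r.
         x \<in> frontier \<Omega> \<and> 0 < r \<and> ennreal r < \<nu>}"

definition BMO_b_norm ::
    "ennreal \<Rightarrow> ennreal \<Rightarrow> (real ^ 'n) set \<Rightarrow> (real ^ 'n \<Rightarrow> real) \<Rightarrow> ennreal" where
  "BMO_b_norm \<mu> \<nu> \<Omega> f = BMO_seminorm \<mu> \<Omega> f + b_seminorm \<nu> \<Omega> f"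

definition BMO_b :: "ennreal \<Rightarrow> ennreal \<Rightarrow> (real ^ 'n) set \<Rightarrow> (real ^ 'n \<Rightarrow> real) set" where
  "BMO_b \<mu> \<nu> \<Omega> = {f \<in> L1_loc \<Omega>. BMO_b_norm \<mu> \<nu> \<Omega> f < \<infinity>}"

definition zero_extension :: "(real ^ 'n) set \<Rightarrow> (real ^ 'n \<Rightarrow> real) \<Rightarrow> real ^ 'n \<Rightarrow> real" where
  "zero_extension \<Omega> f x = (if x \<in> \<Omega> then f x else 0)"

end

theory Submission
  imports Defs
begin

text \<open>
  A ball of radius \<open>r < \<mu>\<close> contained in \<open>\<Omega>\<close> or disjoint from it is harmless. By connectedness,
  any other ball contains a point \<open>z\<close> of the boundary, so it is contained in the ball of radius
  \<open>2 r < 2 \<mu> \<le> \<nu>\<close> around \<open>z\<close>; the mean oscillation is at most twice the mean of \<open>\<bar>f\<^sub>0\<bar>\<close>, which is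
  controlled by the boundary seminorm. Local integrability of \<open>f\<^sub>0\<close> follows from the same
  dichotomy, covering a compact set by finitely many balls of a fixed small radius.
\<close>

text \<open>Membership in \<open>L1_loc\<close> speaks only about compact subsets, so
  \<open>\<Omega>\<close> is exhausted by an increasing sequence of compact sets \<open>C n\<close>.
  The products \<open>indicator (C n) y * f y\<close> are measurable. At each point they are
  eventually equal to the zero extension: a point of \<open>\<Omega>\<close> stays in
  \<open>C n\<close> once it has entered, and outside \<open>\<Omega>\<close> all products
  vanish.\<close>

lemma zero_extension_measurable:
  fixes \<Omega> :: "(real ^ 'n) set"
  assumes "open \<Omega>" "f \<in> L1_loc \<Omega>"
  shows "zero_extension \<Omega> f \<in> borel_measurable lebesgue"
proof -
  obtain C where C: "\<And>n. compact (C n)" "\<And>n. C n \<subseteq> \<Omega>" "\<And>n. C n \<subseteq> interior (C (Suc n))"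
    "\<Union>(range C) = \<Omega>"
    using open_Union_compact_subsets[OF assms(1)] by metis
  have mono: "C m \<subseteq> C n" if "m \<le> n" for m n
    using lift_Suc_mono_le[of C, OF _ that] C(3) interior_subset by (meson order_trans)
  have meas: "(\<lambda>y. indicator (C n) y * f y) \<in> borel_measurable lebesgue" for n
  proof -
    have "set_integrable lebesgue (C n) f"
      using assms(2) C(1,2) by (auto simp: L1_loc_def)
    then show ?thesis
      by (auto simp: set_integrable_def dest: borel_measurable_integrable)
  qed
  have "(\<lambda>n. indicator (C n) y * f y) \<longlonglongrightarrow> zero_extension \<Omega> f y" for y
  proof (cases "y \<in> \<Omega>")
    case True
    then obtain m where "y \<in> C m" using C(4) by blast
    then have "\<forall>\<^sub>F n in sequentially. indicator (C n) y * f y = zero_extension \<Omega> f y"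
      using mono True
      by (intro eventually_sequentiallyI[of m]) (auto simp: zero_extension_def indicator_def)
    then show ?thesis by (rule tendsto_eventually)
  next
    case False
    then have "(\<lambda>n. indicator (C n) y * f y) = (\<lambda>n. 0)"
      using C(2) by (auto simp: indicator_def fun_eq_iff)
    with False show ?thesis by (simp only: zero_extension_def if_False tendsto_const)
  qed
  then show ?thesis
    by (rule borel_measurable_LIMSEQ_real) (rule meas)
qed

text \<open>Pointwise, the oscillation is at most \<open>\<bar>g y\<bar>\<close> plus the modulus of
  the average, and the latter integrates over \<open>B\<close> to at most the integral of
  \<open>\<bar>g\<bar>\<close>.\<close>

lemma nn_integral_oscillation_le:
  fixes g :: "real ^ 'n \<Rightarrow> real"
  assumes B: "B \<in> lmeasurable" "measure lebesgue B > 0" and g: "set_integrable lebesgue B g"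
  shows "(\<integral>\<^sup>+y\<in>B. ennreal \<bar>g y - average g B\<bar> \<partial>lebesgue)
           \<le> 2 * (\<integral>\<^sup>+y\<in>B. ennreal \<bar>g y\<bar> \<partial>lebesgue)"
proof -
  define a where "a = average g B"
  have gm: "(\<lambda>y. indicator B y * g y) \<in> borel_measurable lebesgue"
    using g by (auto simp: set_integrable_def dest: borel_measurable_integrable)
  have Bs: "B \<in> sets lebesgue" using B(1) by (simp add: fmeasurableD)
  have nn_g: "(\<integral>\<^sup>+y\<in>B. ennreal \<bar>g y\<bar> \<partial>lebesgue) = ennreal (LINT y:B|lebesgue. \<bar>g y\<bar>)"
    using set_integrable_abs[OF g] unfolding nn_integral_set_ennreal
    by (subst nn_integral_eq_integral)
      (auto simp: set_integrable_def set_lebesgue_integral_def mult.commute)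
  have "\<bar>a\<bar> * measure lebesgue B = \<bar>LINT y:B|lebesgue. g y\<bar>"
    using B(2) by (simp add: a_def average_def)
  also have "\<dots> \<le> (LINT y:B|lebesgue. \<bar>g y\<bar>)"
    using set_integral_norm_bound[OF g] by simp
  finally have a: "ennreal (\<bar>a\<bar> * measure lebesgue B) \<le> (\<integral>\<^sup>+y\<in>B. ennreal \<bar>g y\<bar> \<partial>lebesgue)"
    unfolding nn_g by (rule ennreal_leI)
  \<comment> \<open>Measurability of \<open>g\<close> is known only on \<open>B\<close>; the
    indicator is therefore kept inside the absolute value, where additivity of the integral can use
    \<open>gm\<close>.\<close>
  have "(\<integral>\<^sup>+y\<in>B. ennreal \<bar>g y - a\<bar> \<partial>lebesgue)
      \<le> (\<integral>\<^sup>+y. ennreal \<bar>indicator B y * g y\<bar> + ennreal \<bar>a\<bar> * indicator B y \<partial>lebesgue)"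
    by (intro nn_integral_mono)
      (auto simp: indicator_def ennreal_plus[symmetric] simp del: ennreal_plus intro!: ennreal_leI)
  also have "\<dots> = (\<integral>\<^sup>+y. ennreal \<bar>indicator B y * g y\<bar> \<partial>lebesgue) + ennreal \<bar>a\<bar> * emeasure lebesgue B"
    using gm Bs by (simp add: nn_integral_add nn_integral_cmult)
  also have "(\<integral>\<^sup>+y. ennreal \<bar>indicator B y * g y\<bar> \<partial>lebesgue) = (\<integral>\<^sup>+y\<in>B. ennreal \<bar>g y\<bar> \<partial>lebesgue)"
    by (intro nn_integral_cong) (auto simp: indicator_def)
  also have "ennreal \<bar>a\<bar> * emeasure lebesgue B = ennreal (\<bar>a\<bar> * measure lebesgue B)"
    using B(1) by (simp add: emeasure_eq_measure2 ennreal_mult fmeasurableD2 emeasure_eq_ennreal_measure)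
  finally show ?thesis
    unfolding a_def[symmetric] using a by (simp add: mult_2) (meson add_left_mono order_trans)
qed

text \<open>The connectedness that matters is that of the ball, not of \<open>\<Omega>\<close>: a
  ball meeting both \<open>\<Omega>\<close> and its complement must meet the frontier. Recentring at
  such a frontier point at most doubles the radius.\<close>

lemma cball_frontier_cases:
  fixes \<Omega> :: "'a::euclidean_space set"
  obtains "cball x r \<subseteq> \<Omega>" | "cball x r \<inter> \<Omega> = {}"
    | z where "z \<in> frontier \<Omega>" "cball x r \<subseteq> cball z (2 * r)"
proof -
  have "\<exists>z \<in> frontier \<Omega>. cball x r \<subseteq> cball z (2 * r)"
    if "\<not> cball x r \<subseteq> \<Omega>" "cball x r \<inter> \<Omega> \<noteq> {}"
  proof -
    have "cball x r \<inter> frontier \<Omega> \<noteq> {}"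
      using that by (intro connected_Int_frontier connected_cball) auto
    then obtain z where z: "z \<in> frontier \<Omega>" "dist x z \<le> r" by auto
    have "cball x r \<subseteq> cball z (2 * r)"
    proof
      fix y assume "y \<in> cball x r"
      then show "y \<in> cball z (2 * r)"
        using z(2) dist_triangle[of z y x] by (simp add: dist_commute)
    qed
    with z show ?thesis by blast
  qed
  then show thesis using that by blast
qed

text \<open>This turns \<open>2 * \<mu> \<le> \<nu>\<close> into admissibility of the doubled radius
  in the boundary seminorm. Strictness survives, also for infinite \<open>\<mu>\<close>, because
  \<open>ennreal r\<close> is finite.\<close>

lemma ennreal_double_less:
  fixes \<mu> \<nu> :: ennreal
  assumes "ennreal r < \<mu>" "2 * \<mu> \<le> \<nu>" "0 < r"
  shows "ennreal (2 * r) < \<nu>"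
proof -
  have "ennreal (2 * r) = 2 * ennreal r"
    using assms(3) by (simp add: ennreal_mult)
  also have "\<dots> < 2 * \<mu>"
    using assms(1) by (intro ennreal_mult_strict_left_mono) (auto simp: less_top)
  finally show ?thesis using assms(2) by simp
qed

lemma nn_integral_near_frontier_le:
  fixes \<Omega> :: "(real ^ 'n) set"
  assumes "z \<in> frontier \<Omega>" "0 < s" "ennreal s < \<nu>" "A \<subseteq> cball z s"
  shows "(\<integral>\<^sup>+y\<in>A. ennreal \<bar>zero_extension \<Omega> f y\<bar> \<partial>lebesgue)
           \<le> ennreal (s ^ CARD('n)) * b_seminorm \<nu> \<Omega> f"
proof -
  let ?I = "\<integral>\<^sup>+y\<in>\<Omega> \<inter> cball z s. ennreal \<bar>f y\<bar> \<partial>lebesgue"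
  have "(\<integral>\<^sup>+y\<in>A. ennreal \<bar>zero_extension \<Omega> f y\<bar> \<partial>lebesgue) \<le> ?I"
    using assms(4) by (intro nn_integral_mono) (auto simp: indicator_def zero_extension_def)
  \<comment> \<open>The factor is positive and finite, so it cancels even if \<open>?I\<close> is
    infinite.\<close>
  also have "?I = ennreal (s ^ CARD('n)) * (?I / ennreal (s ^ CARD('n)))"
    using assms(2)
    by (simp add: ennreal_times_divide mult.commute[of "ennreal _"] mult_divide_eq_ennreal)
  also have "\<dots> \<le> ennreal (s ^ CARD('n)) * b_seminorm \<nu> \<Omega> f"
    unfolding b_seminorm_def using assms(1-3) by (intro mult_left_mono Sup_upper) auto
  finally show ?thesis .
qed

text \<open>Local integrability of \<open>f\<close> settles only balls inside
  \<open>\<Omega>\<close>. Near the frontier, where it gives no control, finiteness comes from the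
  boundary seminorm.\<close>

lemma zero_extension_cball_integral_finite:
  fixes \<Omega> :: "(real ^ 'n) set"
  assumes f: "f \<in> L1_loc \<Omega>" "b_seminorm \<nu> \<Omega> f < \<infinity>" and r: "0 < r" "ennreal (2 * r) < \<nu>"
  shows "(\<integral>\<^sup>+y\<in>cball x r. ennreal \<bar>zero_extension \<Omega> f y\<bar> \<partial>lebesgue) < \<infinity>"
proof (cases rule: cball_frontier_cases[of x r \<Omega>])
  case 1
  then have "set_integrable lebesgue (cball x r) f"
    using f(1) by (auto simp: L1_loc_def)
  then have "(\<integral>\<^sup>+y. ennreal (norm (indicator (cball x r) y *\<^sub>R f y)) \<partial>lebesgue) < \<infinity>"
    by (simp add: set_integrable_def integrable_iff_bounded)
  also have "(\<integral>\<^sup>+y. ennreal (norm (indicator (cball x r) y *\<^sub>R f y)) \<partial>lebesgue)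
      = (\<integral>\<^sup>+y\<in>cball x r. ennreal \<bar>zero_extension \<Omega> f y\<bar> \<partial>lebesgue)"
    using 1 by (intro nn_integral_cong) (auto simp: indicator_def zero_extension_def)
  finally show ?thesis .
next
  case 2
  then have "(\<integral>\<^sup>+y\<in>cball x r. ennreal \<bar>zero_extension \<Omega> f y\<bar> \<partial>lebesgue) = (\<integral>\<^sup>+y. 0 \<partial>(lebesgue :: (real^'n) measure))"
    by (intro nn_integral_cong) (auto simp: indicator_def zero_extension_def)
  then show ?thesis by simp
next
  case (3 z)
  have "(\<integral>\<^sup>+y\<in>cball x r. ennreal \<bar>zero_extension \<Omega> f y\<bar> \<partial>lebesgue)
      \<le> ennreal ((2 * r) ^ CARD('n)) * b_seminorm \<nu> \<Omega> f"
    using 3 r by (intro nn_integral_near_frontier_le) auto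
  also have "\<dots> < \<infinity>"
    using f(2) by (auto simp: ennreal_mult_less_top less_top)
  finally show ?thesis .
qed

lemma zero_extension_L1_loc:
  fixes \<Omega> :: "(real ^ 'n) set"
  assumes \<Omega>: "open \<Omega>" and f: "f \<in> L1_loc \<Omega>" "b_seminorm \<nu> \<Omega> f < \<infinity>" and "0 < \<nu>"
  shows "zero_extension \<Omega> f \<in> L1_loc UNIV"
  unfolding L1_loc_def
proof (intro CollectI allI impI)
  fix K :: "(real ^ 'n) set" assume "compact K \<and> K \<subseteq> UNIV"
  then have K: "compact K" by simp
  \<comment> \<open>Since \<open>\<nu>\<close> may be infinite, a real \<open>s\<close> below it is
    chosen first; half of it is a radius whose double is still admissible.\<close>
  obtain s where s: "0 < s" "ennreal s < \<nu>"
  proof -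
    obtain t where t: "0 < t" "t < \<nu>" using dense[OF \<open>0 < \<nu>\<close>] by blast
    then have "t < top" using less_le_trans top_greatest by blast
    with t show thesis by (intro that[of "enn2real t"]) (auto simp: enn2real_positive_iff)
  qed
  define r where "r = s / 2"
  have r: "0 < r" "ennreal (2 * r) < \<nu>" using s by (auto simp: r_def)
  obtain T where T: "finite T" "K \<subseteq> (\<Union>x\<in>T. cball x r)"
  proof -
    obtain T where "T \<subseteq> K" "finite T" "K \<subseteq> (\<Union>x\<in>T. ball x r)"
      using compactE_image[OF K, of K "\<lambda>x. ball x r"] r(1) by (metis UN_I centre_in_ball open_ball subsetI)
    moreover have "(\<Union>x\<in>T. ball x r) \<subseteq> (\<Union>x\<in>T. cball x r)"
      by (intro UN_mono ball_subset_cball subset_refl)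
    ultimately show thesis by (intro that[of T]) auto
  qed
  have m: "zero_extension \<Omega> f \<in> borel_measurable lebesgue"
    by (rule zero_extension_measurable[OF \<Omega> f(1)])
  have "set_integrable lebesgue (cball x r) (zero_extension \<Omega> f)" for x
    unfolding set_integrable_def
  proof (rule integrableI_bounded)
    have "(\<integral>\<^sup>+y. ennreal (norm (indicator (cball x r) y *\<^sub>R zero_extension \<Omega> f y)) \<partial>lebesgue)
      = (\<integral>\<^sup>+y\<in>cball x r. ennreal \<bar>zero_extension \<Omega> f y\<bar> \<partial>lebesgue)"
      by (intro nn_integral_cong) (auto simp: indicator_def)
    also have "\<dots> < \<infinity>" by (rule zero_extension_cball_integral_finite[OF f r])
    finally show "(\<integral>\<^sup>+y. ennreal (norm (indicator (cball x r) y *\<^sub>R zero_extension \<Omega> f y)) \<partial>lebesgue) < \<infinity>" .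
  qed (intro borel_measurable_scaleR borel_measurable_indicator m, simp)
  then have "set_integrable lebesgue (\<Union>x\<in>T. cball x r) (zero_extension \<Omega> f)"
    using T(1) by (intro set_integrable_UN) auto
  then show "zero_extension \<Omega> f absolutely_integrable_on K"
    by (rule set_integrable_subset) (use T(2) K in \<open>auto simp: lmeasurable_compact fmeasurableD\<close>)
qed

lemma zero_extension_oscillation_le:
  fixes \<Omega> :: "(real ^ 'n) set"
  assumes f: "zero_extension \<Omega> f \<in> L1_loc UNIV" and "2 * \<mu> \<le> \<nu>" and r: "0 < r" "ennreal r < \<mu>"
  shows "(\<integral>\<^sup>+y\<in>cball x r. ennreal \<bar>zero_extension \<Omega> f y - average (zero_extension \<Omega> f) (cball x r)\<bar> \<partial>lebesgue)
           / emeasure lebesgue (cball x r)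
         \<le> BMO_seminorm \<mu> \<Omega> f
             + ennreal (2 ^ (CARD('n) + 1) / unit_ball_vol (CARD('n))) * b_seminorm \<nu> \<Omega> f"
proof -
  let ?g = "zero_extension \<Omega> f" and ?B = "cball x r"
  let ?osc = "\<lambda>h. (\<integral>\<^sup>+y\<in>?B. ennreal \<bar>h y - average h ?B\<bar> \<partial>lebesgue)"
  \<comment> \<open>With n the dimension, this is \<open>2 * (2 * r)^n\<close> divided by the volume
    of a ball of radius \<open>r\<close>: one factor 2 from the oscillation bound,
    \<open>2^n\<close> from doubling the radius. The radius cancels, so the bound is uniform over
    all balls.\<close>
  let ?c = "2 ^ (CARD('n) + 1) / unit_ball_vol (CARD('n))"
  have v: "unit_ball_vol (CARD('n)) > 0" by simp
  have em: "emeasure lebesgue ?B = ennreal (unit_ball_vol (CARD('n)) * r ^ CARD('n))"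
    using r(1) emeasure_cball[of r x] by simp
  have pos: "0 < unit_ball_vol (CARD('n)) * r ^ CARD('n)" using v r(1) by simp
  have int: "set_integrable lebesgue ?B ?g"
    using f by (auto simp: L1_loc_def)
  have "measure lebesgue ?B > 0"
    using em pos by (simp add: measure_def)
  then have twice: "?osc ?g \<le> 2 * (\<integral>\<^sup>+y\<in>?B. ennreal \<bar>?g y\<bar> \<partial>lebesgue)"
    using int by (intro nn_integral_oscillation_le) auto
  show ?thesis
  proof (cases rule: cball_frontier_cases[of x r \<Omega>])
    \<comment> \<open>On the ball the extension agrees with \<open>f\<close>, so averages and
      oscillations coincide and the ball is one of those in the seminorm over
      \<open>\<Omega>\<close>.\<close>
    case 1
    have eq: "?g y = f y" if "y \<in> ?B" for y
      using that 1 by (auto simp: zero_extension_def)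
    have "average ?g ?B = average f ?B"
      unfolding average_def using eq
      by (intro arg_cong2[where f = "(/)"] refl set_lebesgue_integral_cong) auto
    then have "?osc ?g = ?osc f"
      using eq by (intro nn_integral_cong) (auto simp: indicator_def)
    moreover have "?osc f / emeasure lebesgue ?B \<le> BMO_seminorm \<mu> \<Omega> f"
      unfolding BMO_seminorm_def using r 1 by (intro Sup_upper) auto
    ultimately show ?thesis by (simp add: add_increasing2)
  next
    case 2
    then have "(\<integral>\<^sup>+y\<in>?B. ennreal \<bar>?g y\<bar> \<partial>lebesgue) = (\<integral>\<^sup>+y. 0 \<partial>(lebesgue :: (real^'n) measure))"
      by (intro nn_integral_cong) (auto simp: indicator_def zero_extension_def)
    then show ?thesis using twice by simp
  next
    case (3 z)
    have "?osc ?g \<le> 2 * (ennreal ((2 * r) ^ CARD('n)) * b_seminorm \<nu> \<Omega> f)"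
      using 3 r ennreal_double_less[OF r(2) assms(2) r(1)]
      by (intro order_trans[OF twice] mult_left_mono nn_integral_near_frontier_le) auto
    then have "?osc ?g / emeasure lebesgue ?B
        \<le> 2 * (ennreal ((2 * r) ^ CARD('n)) * b_seminorm \<nu> \<Omega> f) / emeasure lebesgue ?B"
      by (rule divide_right_mono_ennreal)
    also have "\<dots> = ennreal (2 * (2 * r) ^ CARD('n)) / emeasure lebesgue ?B * b_seminorm \<nu> \<Omega> f"
      using r(1) by (simp add: ennreal_mult divide_ennreal_def mult_ac)
    also have "ennreal (2 * (2 * r) ^ CARD('n)) / emeasure lebesgue ?B = ennreal ?c"
      unfolding em using r(1) pos by (subst divide_ennreal) (auto simp: power_mult_distrib)
    finally show ?thesis by (simp add: add_increasing)
  qed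
qed

theorem theorem15:
  fixes \<Omega> :: "(real ^ 'n) set" and \<mu> \<nu> :: ennreal
  assumes "is_domain \<Omega>" and "0 < \<mu>" and "2 * \<mu> \<le> \<nu>"
  shows "\<exists>C::real. 0 \<le> C \<and>
    (\<forall>f \<in> BMO_b \<mu> \<nu> \<Omega>.
       zero_extension \<Omega> f \<in> BMO \<mu> UNIV \<and>
       BMO_seminorm \<mu> UNIV (zero_extension \<Omega> f) \<le> ennreal C * BMO_b_norm \<mu> \<nu> \<Omega> f)"
proof -
  define c where "c = 2 ^ (CARD('n) + 1) / unit_ball_vol (real CARD('n))"
  \<comment> \<open>The two seminorms enter the bound with coefficients 1 and \<open>c\<close>;
    their maximum depends only on the dimension.\<close>
  define C where "C = max 1 c"
  have \<nu>: "0 < \<nu>"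
    using assms(2,3) by (metis ennreal_zero_less_mult_iff order_less_le_trans zero_less_numeral)
  have "zero_extension \<Omega> f \<in> BMO \<mu> UNIV \<and>
      BMO_seminorm \<mu> UNIV (zero_extension \<Omega> f) \<le> ennreal C * BMO_b_norm \<mu> \<nu> \<Omega> f"
    if "f \<in> BMO_b \<mu> \<nu> \<Omega>" for f
  proof -
    have f: "f \<in> L1_loc \<Omega>" and fin: "BMO_b_norm \<mu> \<nu> \<Omega> f < \<infinity>"
      using that by (auto simp: BMO_b_def)
    have loc: "zero_extension \<Omega> f \<in> L1_loc UNIV"
      using assms(1) f fin \<nu>
      by (intro zero_extension_L1_loc[of \<Omega> f \<nu>]) (auto simp: is_domain_def BMO_b_norm_def)
    have "BMO_seminorm \<mu> UNIV (zero_extension \<Omega> f)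
        \<le> BMO_seminorm \<mu> \<Omega> f + ennreal c * b_seminorm \<nu> \<Omega> f"
      unfolding BMO_seminorm_def[of \<mu> UNIV] c_def
      using zero_extension_oscillation_le[OF loc assms(3)] by (intro Sup_least) auto
    also have "\<dots> \<le> ennreal C * BMO_seminorm \<mu> \<Omega> f + ennreal C * b_seminorm \<nu> \<Omega> f"
    proof (intro add_mono mult_right_mono ennreal_leI)
      have "1 * BMO_seminorm \<mu> \<Omega> f \<le> ennreal C * BMO_seminorm \<mu> \<Omega> f"
        by (intro mult_right_mono) (auto simp: C_def)
      then show "BMO_seminorm \<mu> \<Omega> f \<le> ennreal C * BMO_seminorm \<mu> \<Omega> f" by simp
    qed (auto simp: C_def)
    finally have le: "BMO_seminorm \<mu> UNIV (zero_extension \<Omega> f) \<le> ennreal C * BMO_b_norm \<mu> \<nu> \<Omega> f"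
      by (simp add: BMO_b_norm_def distrib_left)
    \<comment> \<open>The estimate itself yields the finiteness required for membership in
      \<open>BMO\<close>.\<close>
    also have "\<dots> < \<infinity>"
      using fin by (auto simp: ennreal_mult_less_top)
    finally show ?thesis using le loc by (simp add: BMO_def)
  qed
  moreover have "0 \<le> C" by (simp add: C_def)
  ultimately show ?thesis by blast
qed

end
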